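(* Let $\psi:\mathbb{R}^m\to\mathbb{R}\cup\{+\infty\}$ be proper, lower semicontinuous and convex, let $p\ge1$ and $\lambda>0$, and let $\{y^k\}_{k\in\mathbb{N}_0}$ be a sequence generated by the exact power proximal point method: $y^0\in\mathbb{R}^m$ and, for all $k\in\mathbb{N}_0$, $$v^k\in\partial\psi(y^{k+1}),\qquad y^{k+1}=y^k-\lambda\nabla\phi^*(v^k).$$ Assume that the set of minimizers $Y^\star=\operatorname{argmin}\psi$ is nonempty and compact, and let $\psi^\star=\min\psi$. Assume moreover that there exist $\delta>0$, $\mu>0$ and $\nu>1$ such that $$\psi(y)-\psi^\star\ge\mu\,d^\nu(y,Y^\star)\qquad\text{for all } y\in\mathcal{N}(Y^\star,\delta):=\{y : d(y,Y^\star)<\delta\}.$$ Let $p>\nu-1$. Then $\{d(y^k,Y^\star)\}_{k\in\mathbb{N}_0}$ converges locally with order $\omega:=\frac{p}{\nu-1}>1$ and rate $\alpha:=\left(\frac{1}{\lambda\mu^q}\right)^\omega$, i.e., $d(y^k,Y^\star)\to 0$ and for all $k$ sufficiently large $$d(y^{k+1},Y^\star)\le\alpha\,d^\omega(y^k,Y^\star).$$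
   Context: $\|\cdot\|$ denotes $\|\cdot\|_r$ on $\mathbb{R}^m$, where either $r=2$ or $r=p+1$. Put $\phi:=\frac1{p+1}\|\cdot\|^{p+1}$, and let $q$ be given by $\frac1{p+1}+\frac1{q+1}=1$ (so $q=1/p$). The convex conjugate is $\phi^*=\frac1{q+1}\|\cdot\|_*^{q+1}$, where $\|\cdot\|_*$ is the dual norm of $\|\cdot\|$. $\partial\psi$ is the convex subdifferential. $d(y,Y^\star):=\inf_{\eta\in Y^\star}\|y-\eta\|$ is the distance in the norm $\|\cdot\|$, and $d^\nu(y,Y^\star)$ denotes its $\nu$-th power. *)

theory Defs
  imports "HOL-Analysis.Analysis"
begin

definition lr_norm :: "real \<Rightarrow> real ^ 'm \<Rightarrow> real" where
  "lr_norm r x = (\<Sum>i\<in>UNIV. \<bar>x $ i\<bar> powr r) powr (1 / r)"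

text \<open>Real-valued infimum, meaningful for nonempty \<open>S\<close>. This is not the library's
  \<open>infdist\<close>, which always measures with the Euclidean metric of the type.\<close>
definition lr_dist :: "real \<Rightarrow> real ^ 'm \<Rightarrow> (real ^ 'm) set \<Rightarrow> real" where
  "lr_dist r y S = (INF \<eta>\<in>S. lr_norm r (y - \<eta>))"

definition power_prox_fun :: "real \<Rightarrow> real \<Rightarrow> real ^ 'm \<Rightarrow> real" where
  "power_prox_fun r p x = 1 / (p + 1) * lr_norm r x powr (p + 1)"

text \<open>Real-valued supremum; it is used only for superlinearly growing \<open>f\<close>, for which the
  set is bounded above for every \<open>v\<close>, so that it is the true conjugate.\<close>
definition convex_conjugate :: "('a::real_inner \<Rightarrow> real) \<Rightarrow> 'a \<Rightarrow> real" where
  "convex_conjugate f v = (SUP x. v \<bullet> x - f x)"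

text \<open>Unspecified at points where \<open>f\<close> is not differentiable.\<close>
definition gradient :: "('a::real_inner \<Rightarrow> real) \<Rightarrow> 'a \<Rightarrow> 'a" where
  "gradient f x = (THE g. GDERIV f x :> g)"

text \<open>Functions with values in \<open>\<real> \<union> {+\<infinity>}\<close> are \<open>ereal\<close>-valued functions that never take the
  value \<open>-\<infinity>\<close>; this exclusion is part of properness.\<close>
definition proper_fun :: "('a \<Rightarrow> ereal) \<Rightarrow> bool" where
  "proper_fun \<psi> \<longleftrightarrow> (\<forall>x. \<psi> x \<noteq> -\<infinity>) \<and> (\<exists>x. \<psi> x \<noteq> \<infinity>)"

text \<open>\<open>Liminf (at x)\<close> is over the punctured neighbourhoods of \<open>x\<close>.\<close>
definition lower_semicontinuous :: "('a::topological_space \<Rightarrow> ereal) \<Rightarrow> bool" where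
  "lower_semicontinuous \<psi> \<longleftrightarrow> (\<forall>x. \<psi> x \<le> Liminf (at x) \<psi>)"

text \<open>In \<open>ereal\<close>, \<open>0 * \<infinity> = 0\<close>, so the endpoints of \<open>{0..1}\<close> impose nothing; for functions
  avoiding \<open>-\<infinity>\<close> the right-hand side never has the form \<open>\<infinity> - \<infinity>\<close>.\<close>
definition convex_fun :: "('a::real_vector \<Rightarrow> ereal) \<Rightarrow> bool" where
  "convex_fun \<psi> \<longleftrightarrow> (\<forall>x y. \<forall>t\<in>{0..1}.
     \<psi> ((1 - t) *\<^sub>R x + t *\<^sub>R y) \<le> ereal (1 - t) * \<psi> x + ereal t * \<psi> y)"

text \<open>For proper \<open>\<psi>\<close> this is empty wherever \<open>\<psi> x = \<infinity>\<close>.\<close>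
definition subdifferential :: "('a::real_inner \<Rightarrow> ereal) \<Rightarrow> 'a \<Rightarrow> 'a set" where
  "subdifferential \<psi> x = {v. \<forall>z. \<psi> z \<ge> \<psi> x + ereal (v \<bullet> (z - x))}"

definition argmin_set :: "('a \<Rightarrow> ereal) \<Rightarrow> 'a set" where
  "argmin_set \<psi> = {x. \<forall>z. \<psi> x \<le> \<psi> z}"

end

theory Submission
  imports Defs
begin

text \<open>
  Write \<open>N\<close> for the norm, \<open>\<phi> = N\<^sup>p\<^sup>+\<^sup>1 / (p + 1)\<close>, \<open>G = \<nabla>\<phi>\<^sup>*\<close>, \<open>d\<close> for the \<open>N\<close>-distance to the set of
  minimizers, and \<open>u\<^sub>k = G v\<^sub>k\<close>, so that \<open>y\<^sub>k - y\<^sub>k\<^sub>+\<^sub>1 = \<lambda> u\<^sub>k\<close>. The estimates use of \<open>G\<close> that \<open>v\<close> is a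
  multiple of a norming functional of \<open>G v\<close>: its dual norm is \<open>N (G v)\<^sup>p\<close> and its value at \<open>G v\<close> is
  \<open>N (G v)\<^sup>p\<^sup>+\<^sup>1\<close> (locale \<open>power_duality\<close>). Three consequences of the subgradient inequality at
  \<open>y\<^sub>k\<^sub>+\<^sub>1\<close> give the rate.

  \<^item> Tested at the minimizer \<open>\<eta>\<close> nearest to \<open>y\<^sub>k\<close>, it says \<open>v\<^sub>k \<bullet> (\<eta> - y\<^sub>k\<^sub>+\<^sub>1) \<le> 0\<close>, hence
    \<open>\<lambda> N u\<^sub>k\<^sup>p\<^sup>+\<^sup>1 = v\<^sub>k \<bullet> (y\<^sub>k - y\<^sub>k\<^sub>+\<^sub>1) \<le> v\<^sub>k \<bullet> (y\<^sub>k - \<eta>) \<le> N u\<^sub>k\<^sup>p d y\<^sub>k\<close>, that is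
    \<open>\<lambda> N u\<^sub>k \<le> d y\<^sub>k\<close>: a step is never longer than the distance to the solutions.

  \<^item> Tested at the minimizer nearest to \<open>y\<^sub>k\<^sub>+\<^sub>1\<close>, it bounds the gap \<open>\<psi> y\<^sub>k\<^sub>+\<^sub>1 - min \<psi>\<close> by
    \<open>N u\<^sub>k\<^sup>p d y\<^sub>k\<^sub>+\<^sub>1\<close>. Near the solutions the growth condition bounds it below by
    \<open>\<mu> (d y\<^sub>k\<^sub>+\<^sub>1)\<^sup>\<nu>\<close>, so \<open>\<mu> (d y\<^sub>k\<^sub>+\<^sub>1)\<close> to the power \<open>\<nu> - 1\<close> is at most \<open>N u\<^sub>k\<^sup>p \<le> (d y\<^sub>k / \<lambda>)\<^sup>p\<close>.
    Solving for \<open>d y\<^sub>k\<^sub>+\<^sub>1\<close> is the claimed estimate.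

  \<^item> Tested at \<open>y\<^sub>k\<close>, it shows that \<open>\<psi>\<close> decreases by at least \<open>\<lambda> N u\<^sub>k\<^sup>p\<^sup>+\<^sup>1\<close>. As \<open>\<psi>\<close> is bounded
    below, \<open>N u\<^sub>k\<close> tends to \<open>0\<close>.

  That the iterates do get near the solutions follows from convexity: far away the growth is still
  at least linear (\<open>gap_ge_linearized_growth\<close>), so a small \<open>N u\<^sub>k\<close> forces a small
  \<open>d y\<^sub>k\<^sub>+\<^sub>1\<close>. The two norms of the theorem enter only as instances of the locale, through the
  Cauchy-Schwarz and the Hoelder inequality.
\<close>

section \<open>Power maps\<close>

text \<open>For \<open>s = 1 / p\<close> these are the gradients of the conjugates: applied to the whole vector for
  the Euclidean norm, and coordinatewise for the \<open>(p + 1)\<close>-norm. The factor \<open>sgn x\<close> gives the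
  value \<open>0\<close> at \<open>0\<close> for every exponent.\<close>
definition power_map :: "real \<Rightarrow> 'a::real_normed_vector \<Rightarrow> 'a" where
  "power_map s x = norm x powr s *\<^sub>R sgn x"

lemma norm_power_map [simp]: "norm (power_map s x) = norm x powr s"
  by (cases "x = 0") (simp_all add: power_map_def norm_sgn)

lemma power_map_inverse:
  assumes "s * t = 1"
  shows "power_map s (power_map t x) = x"
proof (cases "x = 0")
  case False
  have "power_map s (power_map t x) = (norm x powr t) powr s *\<^sub>R sgn x"
    using False unfolding power_map_def[of s] norm_power_map
    by (simp add: power_map_def sgn_scaleR) (simp add: sgn_div_norm)
  also have "(norm x powr t) powr s = norm x"
    using False assms by (simp add: powr_powr mult.commute)
  finally show ?thesis
    using False by (simp add: sgn_div_norm)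
qed (simp add: power_map_def)

lemma inner_power_map: "inner x (power_map s x) = norm x powr (s + 1)" for x :: "'a::real_inner"
proof (cases "x = 0")
  case False
  then have "inner x (power_map s x) = norm x powr s * norm x"
    by (simp add: power_map_def sgn_div_norm dot_square_norm power2_eq_square)
  then show ?thesis by (simp add: powr_mult_base add.commute mult.commute)
qed (simp add: power_map_def)

text \<open>At the origin, where the factor \<open>sgn\<close> is discontinuous, continuity comes from
  the norm \<open>norm x powr s\<close> tending to \<open>0\<close>.\<close>

lemma continuous_on_power_map:
  assumes "s > 0"
  shows "continuous_on UNIV (power_map s :: 'a::real_normed_vector \<Rightarrow> 'a)"
proof -
  have "isCont (power_map s) x" for x :: 'a
  proof (cases "x = 0")
    case True
    have "((\<lambda>x :: 'a. norm x powr s) \<longlongrightarrow> norm (0 :: 'a) powr s) (at 0)"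
      using assms by (intro tendsto_powr' tendsto_norm tendsto_ident_at tendsto_const) auto
    then have "((\<lambda>x :: 'a. norm (power_map s x)) \<longlongrightarrow> 0) (at 0)"
      using assms by simp
    then show ?thesis
      using True tendsto_norm_zero_cancel[of "power_map s"] by (simp add: isCont_def power_map_def)
  next
    case False
    then show ?thesis
      unfolding power_map_def sgn_div_norm by (intro continuous_intros) auto
  qed
  then show ?thesis
    by (simp add: continuous_on_eq_continuous_at)
qed

section \<open>Hoelder's inequality for finite sums\<close>

text \<open>After normalizing both factors, the inequality is the sum of Young's inequalities for the
  single terms.\<close>

lemma Hoelder_sum:
  fixes a b :: "'i \<Rightarrow> real"
  assumes "finite I" and PQ: "P > 1" "Q > 1" "1/P + 1/Q = 1"
    and a: "\<And>i. i \<in> I \<Longrightarrow> a i \<ge> 0" and b: "\<And>i. i \<in> I \<Longrightarrow> b i \<ge> 0"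
  shows "(\<Sum>i\<in>I. a i * b i) \<le> (\<Sum>i\<in>I. a i powr P) powr (1/P) * (\<Sum>i\<in>I. b i powr Q) powr (1/Q)"
proof (cases "(\<Sum>i\<in>I. a i powr P) = 0 \<or> (\<Sum>i\<in>I. b i powr Q) = 0")
  case True
  then have "a i * b i = 0" if "i \<in> I" for i
    using that assms(1) by (auto simp: sum_nonneg_eq_0_iff)
  then have "(\<Sum>i\<in>I. a i * b i) = 0"
    by (rule sum.neutral[OF ballI])
  then show ?thesis
    by simp
next
  case False
  define A B where "A = (\<Sum>i\<in>I. a i powr P) powr (1/P)" and "B = (\<Sum>i\<in>I. b i powr Q) powr (1/Q)"
  have AP: "A powr P = (\<Sum>i\<in>I. a i powr P)" and BQ: "B powr Q = (\<Sum>i\<in>I. b i powr Q)"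
    using PQ by (auto simp: A_def B_def powr_powr sum_nonneg)
  have pos: "A > 0" "B > 0"
    using False by (auto simp: A_def B_def)
  have "(\<Sum>i\<in>I. (a i / A) * (b i / B)) \<le> (\<Sum>i\<in>I. (a i / A) powr P / P + (b i / B) powr Q / Q)"
    using PQ a b pos by (intro sum_mono Youngs_inequality) auto
  also have "\<dots> = (\<Sum>i\<in>I. a i powr P) / A powr P / P + (\<Sum>i\<in>I. b i powr Q) / B powr Q / Q"
    using a b pos by (simp add: sum.distrib powr_divide sum_divide_distrib)
  also have "\<dots> = 1"
    using False PQ by (simp add: AP BQ)
  finally have "(\<Sum>i\<in>I. a i * b i) / (A * B) \<le> 1"
    by (simp add: sum_divide_distrib)
  then show ?thesis
    using pos by (simp add: A_def[symmetric] B_def[symmetric] divide_le_eq)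
qed

section \<open>Norms with a power duality map\<close>

text \<open>The map \<open>G\<close> stands for the gradient of the conjugate of \<open>N powr (p + 1) / (p + 1)\<close>.
  The last two conditions say that \<open>v\<close> has dual norm \<open>N (G v) powr p\<close> and attains it in
  the direction \<open>G v\<close>. The triangle inequality for \<open>N\<close> is a consequence.\<close>

locale power_duality =
  fixes N :: "'a::euclidean_space \<Rightarrow> real" and p :: real and G :: "'a \<Rightarrow> 'a"
  assumes p_pos: "p > 0"
    and N_nonneg: "N x \<ge> 0"
    and N_scaleR: "N (c *\<^sub>R x) = \<bar>c\<bar> * N x"
    and continuous_N: "continuous_on UNIV N"
    and continuous_G: "continuous_on UNIV G"
    and surj_G: "surj G"
    and inner_le: "inner v x \<le> N (G v) powr p * N x"
    and inner_G: "inner v (G v) = N (G v) powr (p + 1)"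
begin

lemma powr_Suc_N: "N x powr p * N x = N x powr (p + 1)"
  using N_nonneg[of x] by (simp add: powr_mult_base mult.commute add.commute)

text \<open>By surjectivity of \<open>G\<close>, some functional attains its norm at \<open>x + y\<close>. Apply it to
  both summands.\<close>

lemma N_triangle: "N (x + y) \<le> N x + N y"
proof (cases "N (x + y) = 0")
  case False
  obtain v where v: "x + y = G v"
    using surj_G by (metis surjD)
  have "N (x + y) powr p * N (x + y) = inner v x + inner v y"
    unfolding powr_Suc_N by (metis inner_G inner_add_right v)
  also have "\<dots> \<le> N (x + y) powr p * (N x + N y)"
    using inner_le[of v x] inner_le[of v y] by (simp add: v distrib_left)
  finally show ?thesis
    using False by simp
qed (simp add: N_nonneg add_nonneg_nonneg)

definition phi :: "'a \<Rightarrow> real" where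
  "phi x = 1 / (p + 1) * N x powr (p + 1)"

text \<open>\<open>G v\<close> maximizes \<open>v \<bullet> x - phi x\<close>: replacing \<open>v \<bullet> x\<close> by its bound
  \<open>N (G v) powr p * N x\<close> leaves a maximization over the number \<open>N x\<close>, which is
  Young's inequality.\<close>

lemma G_maximizes_Fenchel: "inner v x - phi x \<le> inner v (G v) - phi (G v)"
proof -
  have "N (G v) powr p * N x \<le> (N (G v) powr p) powr ((p+1)/p) / ((p+1)/p) + N x powr (p+1) / (p+1)"
    using p_pos N_nonneg[of x] by (intro Youngs_inequality) (auto simp: field_simps)
  also have "(N (G v) powr p) powr ((p+1)/p) / ((p+1)/p) = N (G v) powr (p + 1) - phi (G v)"
  proof -
    have "p * ((p+1)/p) = p + 1"
      using p_pos by simp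
    then show ?thesis
      using p_pos by (simp only: phi_def powr_powr) (simp add: field_simps)
  qed
  finally show ?thesis
    using inner_le[of v x] inner_G[of v] by (simp add: phi_def)
qed

lemma convex_conjugate_phi: "convex_conjugate phi v = inner v (G v) - phi (G v)"
  unfolding convex_conjugate_def
  by (rule cSup_eq_maximum) (use G_maximizes_Fenchel in auto)

text \<open>The conjugate is a maximum of affine functions, attained at \<open>G\<close>. Comparing the maximizers
  at \<open>v\<close> and \<open>w\<close> squeezes the linearization error at \<open>v\<close> between \<open>0\<close> and
  \<open>(w - v) \<bullet> (G w - G v)\<close>, which is of smaller order than \<open>w - v\<close> as soon as \<open>G\<close>
  is continuous. No explicit formula for the conjugate has to be differentiated.\<close>

lemma gradient_conjugate_phi: "gradient (convex_conjugate phi) v = G v"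
proof -
  have G: "GDERIV (convex_conjugate phi) v :> G v"
    unfolding gderiv_def
  proof (rule has_derivativeI_sandwich[where e = 1 and H = "\<lambda>w. norm (G w - G v)"])
    show "bounded_linear (\<lambda>h. inner h (G v))"
      by (rule bounded_linear_inner_left)
    have "continuous (at v) G"
      using continuous_G by (simp add: continuous_on_eq_continuous_at)
    then show "((\<lambda>w. norm (G w - G v)) \<longlongrightarrow> 0) (at v)"
      using LIM_zero tendsto_norm_zero isCont_def by blast
    fix w assume "w \<noteq> v"
    let ?e = "convex_conjugate phi w - convex_conjugate phi v - inner (w - v) (G v)"
    have "?e \<ge> 0"
      using G_maximizes_Fenchel[of w "G v"] by (simp add: convex_conjugate_phi inner_diff_left)
    moreover have "?e \<le> inner (w - v) (G w - G v)"
      using G_maximizes_Fenchel[of v "G w"]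
      by (simp add: convex_conjugate_phi inner_diff_left inner_diff_right)
    moreover have "\<dots> \<le> norm (w - v) * norm (G w - G v)"
      by (rule norm_cauchy_schwarz)
    ultimately show "norm ?e / norm (w - v) \<le> norm (G w - G v)"
      using \<open>w \<noteq> v\<close> by (simp add: divide_le_eq mult.commute)
  qed auto
have "g = G v" if "GDERIV (convex_conjugate phi) v :> g" for g
  proof -
    have "(\<lambda>h. inner h g) = (\<lambda>h. inner h (G v))"
      using has_derivative_unique that G unfolding gderiv_def by blast
    then have "inner (g - G v) (g - G v) = 0"
      by (metis inner_diff_right right_minus_eq)
    then show ?thesis
      by simp
  qed
  with G show ?thesis
    unfolding gradient_def by (rule the_equality)
qed


section \<open>Distance and growth along segments\<close>

definition gdist :: "'a \<Rightarrow> 'a set \<Rightarrow> real" where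
  "gdist x S = (INF \<eta>\<in>S. N (x - \<eta>))"

lemma gdist_le:
  assumes "\<eta> \<in> S"
  shows "gdist x S \<le> N (x - \<eta>)"
  unfolding gdist_def using assms by (intro cINF_lower bdd_belowI2[of _ 0]) (auto simp: N_nonneg)

lemma gdist_nonneg:
  assumes "S \<noteq> {}"
  shows "gdist x S \<ge> 0"
  unfolding gdist_def using N_nonneg assms by (intro cINF_greatest) auto

lemma gdist_attained:
  assumes "compact S" "S \<noteq> {}"
  obtains \<eta> where "\<eta> \<in> S" "gdist x S = N (x - \<eta>)"
proof -
  have "continuous_on S (\<lambda>\<eta>. N (x - \<eta>))"
    by (rule continuous_on_compose2[OF continuous_N]) (auto intro: continuous_intros)
  then obtain \<eta> where \<eta>: "\<eta> \<in> S" "\<And>z. z \<in> S \<Longrightarrow> N (x - \<eta>) \<le> N (x - z)"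
    using continuous_attains_inf[OF assms] by blast
  have "gdist x S = N (x - \<eta>)"
    unfolding gdist_def by (rule cInf_eq_minimum) (use \<eta> in auto)
  with \<eta>(1) show ?thesis
    by (rule that)
qed

text \<open>A point on the segment from \<open>x\<close> to its nearest point \<open>\<eta>\<close> still has \<open>\<eta>\<close> as a nearest point,
  since a closer one would by the triangle inequality also be closer to \<open>x\<close>.\<close>

lemma gdist_segment:
  assumes \<eta>: "\<eta> \<in> S" "gdist x S = N (x - \<eta>)" and t: "0 \<le> t" "t \<le> 1"
  shows "gdist ((1 - t) *\<^sub>R \<eta> + t *\<^sub>R x) S = t * gdist x S"
proof (rule antisym)
  let ?z = "(1 - t) *\<^sub>R \<eta> + t *\<^sub>R x"
  have "?z - \<eta> = t *\<^sub>R (x - \<eta>)"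
    by (simp add: algebra_simps)
  then show "gdist ?z S \<le> t * gdist x S"
    using gdist_le[OF \<eta>(1), of ?z] t by (simp add: \<eta>(2) N_scaleR)
  have "x - ?z = (1 - t) *\<^sub>R (x - \<eta>)"
    by (simp add: algebra_simps)
  then have xz: "N (x - ?z) = (1 - t) * gdist x S"
    using t by (simp add: \<eta>(2) N_scaleR)
  have "t * gdist x S \<le> N (?z - \<zeta>)" if "\<zeta> \<in> S" for \<zeta>
    using gdist_le[OF that, of x] N_triangle[of "x - ?z" "?z - \<zeta>"] xz
    by (simp add: algebra_simps)
  then show "t * gdist x S \<le> gdist ?z S"
    unfolding gdist_def[of ?z] using \<eta>(1) by (intro cINF_greatest) auto
qed

text \<open>Beyond distance \<open>c\<close>, where the growth condition may say nothing, convexity continues it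
  linearly: on the segment from the nearest minimizer to \<open>x\<close>, the gap at the point of distance
  \<open>c\<close> is at most the proportional part of the gap at \<open>x\<close>. Within distance \<open>c\<close> the
  bound is the growth condition itself; the minimum covers both cases.\<close>

lemma gap_ge_linearized_growth:
  assumes conv: "convex_fun \<psi>"
    and S: "compact S" "S \<noteq> {}"
    and min: "\<And>\<eta>. \<eta> \<in> S \<Longrightarrow> \<psi> \<eta> = ereal m"
    and growth: "\<And>z. gdist z S < \<delta> \<Longrightarrow> ereal (m + \<mu> * gdist z S powr \<nu>) \<le> \<psi> z"
    and c: "0 < c" "c < \<delta>"
    and x: "\<psi> x = ereal a" "gdist x S > 0"
  shows "\<mu> * min (gdist x S) c powr (\<nu> - 1) * gdist x S \<le> a - m"
proof -
  let ?d = "gdist x S"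
  define t where "t = min ?d c / ?d"
  have t: "0 < t" "t \<le> 1" "t * ?d = min ?d c"
    using x(2) c by (auto simp: t_def divide_le_eq)
  obtain \<eta> where \<eta>: "\<eta> \<in> S" "?d = N (x - \<eta>)"
    using gdist_attained[OF S] by blast
  let ?z = "(1 - t) *\<^sub>R \<eta> + t *\<^sub>R x"
  have z: "gdist ?z S = t * ?d"
    using gdist_segment[OF \<eta>] t by simp
  have "ereal (m + \<mu> * (t * ?d) powr \<nu>) \<le> \<psi> ?z"
    using growth[of ?z] c unfolding z t(3) by simp
  also have "\<dots> \<le> ereal (1 - t) * \<psi> \<eta> + ereal t * \<psi> x"
    using conv t unfolding convex_fun_def by simp
  also have "\<dots> = ereal (m + t * (a - m))"
    by (simp add: min[OF \<eta>(1)] x(1) algebra_simps)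
  finally have "\<mu> * (t * ?d) powr \<nu> \<le> t * (a - m)"
    by simp
  moreover have "(t * ?d) powr \<nu> = (t * ?d) * (t * ?d) powr (\<nu> - 1)"
    using powr_mult_base[of "t * ?d" "\<nu> - 1"] t(1) x(2) by simp
  ultimately have "t * (\<mu> * (?d * (t * ?d) powr (\<nu> - 1))) \<le> t * (a - m)"
    by (simp only: mult_ac)
  then have "\<mu> * (?d * (t * ?d) powr (\<nu> - 1)) \<le> a - m"
    using t(1) by (simp only: mult_le_cancel_left_pos)
  then show ?thesis
    unfolding t(3) by (simp only: mult_ac)
qed

section \<open>Local convergence of the power proximal point method\<close>

text \<open>Here \<open>1 / p\<close> is the exponent \<open>q\<close> conjugate to \<open>p\<close> in the sense that
  \<open>p + 1\<close> and \<open>q + 1\<close> are Hoelder conjugate.\<close>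

theorem power_proximal_point_local_rate:
  fixes \<psi> :: "'a \<Rightarrow> ereal" and y v :: "nat \<Rightarrow> 'a"
  assumes lam: "lam > 0"
    and proper: "proper_fun \<psi>"
    and conv: "convex_fun \<psi>"
    and subgrad: "\<And>k. v k \<in> subdifferential \<psi> (y (Suc k))"
    and step: "\<And>k. y (Suc k) = y k - lam *\<^sub>R G (v k)"
    and S: "S = argmin_set \<psi>" "S \<noteq> {}" "compact S"
    and \<delta>: "\<delta> > 0" and \<mu>: "\<mu> > 0" and \<nu>: "\<nu> > 1"
    and growth: "\<And>x. gdist x S < \<delta> \<Longrightarrow> \<psi> x - (INF z. \<psi> z) \<ge> ereal (\<mu> * gdist x S powr \<nu>)"
    and \<omega>: "\<omega> = p / (\<nu> - 1)"
  shows "(\<lambda>k. gdist (y k) S) \<longlonglongrightarrow> 0"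
    and "\<forall>\<^sub>F k in sequentially.
           gdist (y (Suc k)) S \<le> (1 / (lam * \<mu> powr (1/p))) powr \<omega> * gdist (y k) S powr \<omega>"
proof -
  let ?d = "\<lambda>k. gdist (y k) S"
  obtain x0 where x0: "\<psi> x0 \<noteq> \<infinity>" "\<And>x. \<psi> x \<noteq> -\<infinity>"
    using proper unfolding proper_fun_def by auto
  have argmin: "\<psi> \<eta> = (INF z. \<psi> z)" if "\<eta> \<in> S" for \<eta>
    using that unfolding S argmin_set_def by (auto intro!: antisym INF_greatest INF_lower)
  obtain \<eta>0 where \<eta>0: "\<eta>0 \<in> S"
    using S by auto
  have "\<psi> \<eta>0 \<le> \<psi> x0"
    using \<eta>0 unfolding S argmin_set_def by auto
  then obtain m where m: "(INF z. \<psi> z) = ereal m"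
    using x0 argmin[OF \<eta>0] by (metis ereal_cases ereal_infty_less_eq(1))
  have min: "\<psi> \<eta> = ereal m" if "\<eta> \<in> S" for \<eta>
    using argmin[OF that] m by simp
  have sub: "\<psi> z \<ge> \<psi> (y (Suc k)) + ereal (inner (v k) (z - y (Suc k)))" for k z
    using subgrad unfolding subdifferential_def by auto
  have "\<psi> (y (Suc k)) \<noteq> \<infinity>" for k
    using sub[of k x0] x0 by auto
  then have "\<exists>a. \<psi> (y (Suc k)) = ereal a" for k
    using x0(2) by (metis ereal_cases)
  then obtain a where a: "\<And>k. \<psi> (y (Suc k)) = ereal (a k)"
    by metis
  have m_le: "m \<le> a k" for k
    using INF_lower[of "y (Suc k)" UNIV \<psi>] unfolding m a by simp
  define g where "g k = N (G (v k))" for k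
  have g0: "g k \<ge> 0" for k
    by (simp add: g_def N_nonneg)
  have diff: "y k - y (Suc k) = lam *\<^sub>R G (v k)" for k
    by (simp add: step)
  \<comment> \<open>Subgradient inequality at the minimizer nearest to \<open>y (Suc k)\<close>.\<close>
  have gap: "a k - m \<le> g k powr p * ?d (Suc k)" for k
  proof -
    obtain \<eta> where \<eta>: "\<eta> \<in> S" "?d (Suc k) = N (y (Suc k) - \<eta>)"
      using gdist_attained[OF S(3,2)] by blast
    have "a k - m \<le> inner (v k) (y (Suc k) - \<eta>)"
      using sub[of k \<eta>] by (simp add: a min[OF \<eta>(1)] inner_diff_right)
    also have "\<dots> \<le> g k powr p * ?d (Suc k)"
      unfolding \<eta>(2) g_def by (rule inner_le)
    finally show ?thesis .
  qed
  \<comment> \<open>Subgradient inequality at the minimizer nearest to \<open>y k\<close>; a step is no longer than the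
    distance to the solutions.\<close>
  have step_le: "lam * g k \<le> ?d k" for k
  proof (cases "g k = 0")
    case False
    obtain \<eta> where \<eta>: "\<eta> \<in> S" "?d k = N (y k - \<eta>)"
      using gdist_attained[OF S(3,2)] by blast
    have "g k powr p * (lam * g k) = inner (v k) (y k - y (Suc k))"
      using powr_Suc_N[of "G (v k)"] by (simp add: diff inner_G g_def)
    also have "\<dots> \<le> inner (v k) (y k - \<eta>)"
      using sub[of k \<eta>] m_le[of k] by (simp add: a min[OF \<eta>(1)] inner_diff_right)
    also have "\<dots> \<le> g k powr p * ?d k"
      unfolding \<eta>(2) g_def by (rule inner_le)
    finally show ?thesis
      using False by simp
  qed (simp add: gdist_nonneg[OF S(2)])
  \<comment> \<open>\<open>\<psi> (y 0)\<close> may be infinite, so the decrease is only stated from \<open>y 1\<close> on.\<close>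
  have decrease: "lam * g (Suc k) powr (p + 1) \<le> a k - a (Suc k)" for k
    using sub[of "Suc k" "y (Suc k)"] unfolding diff a by (simp add: inner_G g_def)
  have decrease_lim: "(\<lambda>k. a k - a (Suc k)) \<longlonglongrightarrow> 0"
  proof -
    have "a (Suc k) \<le> a k" for k
    proof -
      have "0 \<le> lam * g (Suc k) powr (p + 1)"
        using lam by simp
      with decrease[of k] show ?thesis
        by simp
    qed
    then obtain l where "a \<longlonglongrightarrow> l"
      using decseq_convergent[OF decseq_SucI, of a m] m_le by blast
    then show ?thesis
      using tendsto_diff[OF \<open>a \<longlonglongrightarrow> l\<close> LIMSEQ_Suc[OF \<open>a \<longlonglongrightarrow> l\<close>]] by simp
  qed
  have "(\<lambda>k. lam * g (Suc k) powr (p + 1)) \<longlonglongrightarrow> 0"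
    by (rule tendsto_sandwich[OF _ _ tendsto_const decrease_lim]) (use lam decrease in auto)
  then have "(\<lambda>k. (lam * g (Suc k) powr (p + 1) / lam) powr (p / (p + 1))) \<longlonglongrightarrow> (0 / lam) powr (p / (p + 1))"
    using p_pos lam by (intro tendsto_powr' tendsto_divide tendsto_const) auto
  then have "(\<lambda>k. g (Suc k) powr p) \<longlonglongrightarrow> 0"
    using p_pos lam by (simp add: powr_powr)
  then have gp: "(\<lambda>k. g k powr p) \<longlonglongrightarrow> 0"
    by (rule LIMSEQ_imp_Suc)
  have growth': "ereal (m + \<mu> * gdist z S powr \<nu>) \<le> \<psi> z" if "gdist z S < \<delta>" for z
    using growth[OF that] unfolding m by (cases "\<psi> z") auto
  \<comment> \<open>The growth condition is cut off at \<open>\<delta> / 2\<close>, strictly below \<open>\<delta>\<close>. Once the right-hand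
    side is small, the minimum is the distance itself.\<close>
  have key: "\<mu> * min (?d (Suc k)) (\<delta> / 2) powr (\<nu> - 1) \<le> g k powr p" for k
  proof (cases "?d (Suc k) = 0")
    case False
    then have pos: "?d (Suc k) > 0"
      using gdist_nonneg[of S "y (Suc k)"] S by simp
    have "\<mu> * min (?d (Suc k)) (\<delta> / 2) powr (\<nu> - 1) * ?d (Suc k) \<le> g k powr p * ?d (Suc k)"
      using gap_ge_linearized_growth[OF conv S(3,2) min growth' _ _ a pos, where c = "\<delta> / 2" and \<delta> = \<delta>] gap[of k] \<delta>
      by simp
    then show ?thesis
      using pos by simp
  qed (use \<delta> in simp)
  have key': "min (?d (Suc k)) (\<delta> / 2) \<le> (g k powr p / \<mu>) powr (1 / (\<nu> - 1))" for k
  proof -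
    have nonneg: "min (?d (Suc k)) (\<delta> / 2) \<ge> 0"
      using gdist_nonneg[of S "y (Suc k)"] S \<delta> by simp
    have "min (?d (Suc k)) (\<delta> / 2) powr (\<nu> - 1) \<le> g k powr p / \<mu>"
      using key[of k] \<mu> by (simp add: field_simps)
    then have "(min (?d (Suc k)) (\<delta> / 2) powr (\<nu> - 1)) powr (1 / (\<nu> - 1)) \<le> (g k powr p / \<mu>) powr (1 / (\<nu> - 1))"
      using \<nu> by (intro powr_mono2) auto
    then show ?thesis
      using \<nu> nonneg by (simp add: powr_powr)
  qed
  have "(\<lambda>k. (g k powr p / \<mu>) powr (1 / (\<nu> - 1))) \<longlonglongrightarrow> (0 / \<mu>) powr (1 / (\<nu> - 1))"
    using gp \<mu> \<nu> by (intro tendsto_powr' tendsto_divide tendsto_const) auto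
  then have bound: "(\<lambda>k. (g k powr p / \<mu>) powr (1 / (\<nu> - 1))) \<longlonglongrightarrow> 0"
    by simp
  then have "\<forall>\<^sub>F k in sequentially. (g k powr p / \<mu>) powr (1 / (\<nu> - 1)) < \<delta> / 2"
    using \<delta> by (intro order_tendstoD(2)) auto
  then have near: "\<forall>\<^sub>F k in sequentially. ?d (Suc k) \<le> (g k powr p / \<mu>) powr (1 / (\<nu> - 1))"
    by eventually_elim (use key' in \<open>smt (verit)\<close>)
  have "(\<lambda>k. ?d (Suc k)) \<longlonglongrightarrow> 0"
    by (rule tendsto_sandwich[OF _ near tendsto_const bound]) (simp add: gdist_nonneg[OF S(2)])
  then show "?d \<longlonglongrightarrow> 0"
    by (rule LIMSEQ_imp_Suc)
  have rate: "(g k powr p / \<mu>) powr (1 / (\<nu> - 1)) \<le> (1 / (lam * \<mu> powr (1/p))) powr \<omega> * ?d k powr \<omega>" for k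
  proof -
    have "g k \<le> ?d k / lam"
      using step_le[of k] lam by (simp add: field_simps)
    have "(\<mu> powr (1/p)) powr p = \<mu>"
      using p_pos \<mu> by (simp add: powr_powr)
    then have "(g k powr p / \<mu>) powr (1 / (\<nu> - 1)) = ((g k / \<mu> powr (1/p)) powr p) powr (1 / (\<nu> - 1))"
      using g0[of k] \<mu> by (simp add: powr_divide)
    also have "\<dots> = (g k / \<mu> powr (1/p)) powr \<omega>"
      by (simp add: powr_powr \<omega>)
    also have "\<dots> \<le> (?d k / lam / \<mu> powr (1/p)) powr \<omega>"
      using \<open>g k \<le> ?d k / lam\<close> g0[of k] p_pos \<nu> \<mu> by (intro powr_mono2 divide_right_mono) (auto simp: \<omega>)
    also have "\<dots> = ((1 / (lam * \<mu> powr (1/p))) * ?d k) powr \<omega>"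
      by simp
    also have "\<dots> = (1 / (lam * \<mu> powr (1/p))) powr \<omega> * ?d k powr \<omega>"
      by (rule powr_mult)
    finally show ?thesis .
  qed
  show "\<forall>\<^sub>F k in sequentially.
          ?d (Suc k) \<le> (1 / (lam * \<mu> powr (1/p))) powr \<omega> * ?d k powr \<omega>"
    using near by eventually_elim (use rate order_trans in blast)
qed

end

section \<open>The Euclidean norm and the \<open>(p + 1)\<close>-norm\<close>

lemma lr_norm_nonneg: "lr_norm r x \<ge> 0"
  by (simp add: lr_norm_def)

lemma lr_norm_scaleR:
  assumes "r > 0"
  shows "lr_norm r (c *\<^sub>R x) = \<bar>c\<bar> * lr_norm r x"
proof -
  have "lr_norm r (c *\<^sub>R x) = (\<bar>c\<bar> powr r * (\<Sum>i\<in>UNIV. \<bar>x $ i\<bar> powr r)) powr (1/r)"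
    by (simp add: lr_norm_def abs_mult powr_mult sum_distrib_left)
  also have "\<dots> = (\<bar>c\<bar> powr r) powr (1/r) * lr_norm r x"
    unfolding lr_norm_def by (rule powr_mult)
  finally show ?thesis
    using assms by (simp add: powr_powr)
qed

lemma lr_norm_powr:
  assumes "r > 0"
  shows "lr_norm r x powr s = (\<Sum>i\<in>UNIV. \<bar>x $ i\<bar> powr r) powr (s / r)"
  by (simp add: lr_norm_def powr_powr)

lemma continuous_on_lr_norm:
  assumes "r > 0"
  shows "continuous_on UNIV (lr_norm r :: real ^ 'm \<Rightarrow> real)"
  unfolding lr_norm_def using assms
  by (intro continuous_on_powr' continuous_intros) (auto intro: sum_nonneg)

lemma lr_norm_2: "lr_norm 2 x = norm x"
  by (simp add: lr_norm_def norm_vec_def L2_set_def powr_half_sqrt sum_nonneg)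

lemma power_duality_Euclidean:
  assumes "p > 0"
  shows "power_duality (lr_norm 2) p (power_map (1/p) :: real ^ 'm \<Rightarrow> real ^ 'm)"
proof
  fix v x :: "real ^ 'm"
  show "inner v x \<le> lr_norm 2 (power_map (1/p) v) powr p * lr_norm 2 x"
    using assms norm_cauchy_schwarz[of v x] by (simp add: lr_norm_2 powr_powr)
  show "inner v (power_map (1/p) v) = lr_norm 2 (power_map (1/p) v) powr (p + 1)"
    using assms by (simp add: lr_norm_2 inner_power_map powr_powr add_divide_distrib add.commute)
  show "surj (power_map (1/p) :: real ^ 'm \<Rightarrow> real ^ 'm)"
    using assms by (intro surjI[of _ "power_map p"] power_map_inverse) simp
qed (use assms in \<open>simp_all add: lr_norm_nonneg lr_norm_scaleR continuous_on_lr_norm continuous_on_power_map\<close>)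

text \<open>The exponent conjugate to \<open>p + 1\<close> is \<open>(p + 1) / p\<close>, and
  \<open>\<bar>v\<^sub>i\<bar> powr ((p + 1) / p) = \<bar>(G v)\<^sub>i\<bar> powr (p + 1)\<close>, so the dual norm of \<open>v\<close> in
  Hoelder's inequality is the \<open>p\<close>-th power of the norm of \<open>G v\<close>.\<close>

lemma power_duality_lr:
  assumes p: "p > 0"
  shows "power_duality (lr_norm (p + 1)) p (\<lambda>v :: real ^ 'm. \<chi> i. power_map (1/p) (v $ i))"
proof
  let ?G = "\<lambda>v :: real ^ 'm. \<chi> i. power_map (1/p) (v $ i)"
  fix v x :: "real ^ 'm"
  have abs_G: "\<bar>power_map (1/p) t\<bar> powr s = \<bar>t\<bar> powr (s / p)" for t s :: real
    using norm_power_map[of "1/p" t] by (simp add: powr_powr)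
  have NG: "lr_norm (p + 1) (?G v) powr s = (\<Sum>i\<in>UNIV. \<bar>v $ i\<bar> powr ((p + 1) / p)) powr (s / (p + 1))" for s
    using p by (simp add: lr_norm_powr abs_G)
  have "inner v x \<le> (\<Sum>i\<in>UNIV. \<bar>v $ i\<bar> * \<bar>x $ i\<bar>)"
    unfolding inner_vec_def by (intro sum_mono) (metis abs_ge_self abs_mult inner_real_def)
  also have "\<dots> \<le> (\<Sum>i\<in>UNIV. \<bar>v $ i\<bar> powr ((p+1)/p)) powr (1/((p+1)/p)) * (\<Sum>i\<in>UNIV. \<bar>x $ i\<bar> powr (p+1)) powr (1/(p+1))"
    using p by (intro Hoelder_sum) (auto simp: field_simps)
  finally show "inner v x \<le> lr_norm (p + 1) (?G v) powr p * lr_norm (p + 1) x"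
    unfolding NG by (simp add: lr_norm_def[of _ x])
  have "inner v (?G v) = (\<Sum>i\<in>UNIV. \<bar>v $ i\<bar> powr ((p + 1) / p))"
    using p inner_power_map[of "v $ _" "1/p"] by (simp add: inner_vec_def add_divide_distrib add.commute)
  also have "\<dots> = lr_norm (p + 1) (?G v) powr (p + 1)"
    using p by (simp add: NG sum_nonneg)
  finally show "inner v (?G v) = lr_norm (p + 1) (?G v) powr (p + 1)" .
  show "surj ?G"
    using p by (intro surjI[of _ "\<lambda>x. \<chi> i. power_map p (x $ i)"]) (simp add: power_map_inverse)
  show "continuous_on UNIV ?G"
    using p by (intro continuous_on_vec_lambda continuous_on_compose2[OF continuous_on_power_map])
       (auto intro: continuous_intros)
qed (use p in \<open>simp_all add: lr_norm_nonneg lr_norm_scaleR continuous_on_lr_norm\<close>)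

section \<open>Convergence order for both norms\<close>

theorem theorem3p6:
  fixes \<psi> :: "real ^ 'm \<Rightarrow> ereal"
    and y v :: "nat \<Rightarrow> real ^ 'm"
    and Y :: "(real ^ 'm) set"
    and \<psi>min :: ereal
    and p q r lam \<delta> \<mu> \<nu> \<omega> \<alpha> :: real
  assumes p: "p \<ge> 1"
    and q: "1 / (p + 1) + 1 / (q + 1) = 1"
    and r: "r = 2 \<or> r = p + 1"
    and lam: "lam > 0"
    and proper: "proper_fun \<psi>"
    and lsc: "lower_semicontinuous \<psi>"
    and conv: "convex_fun \<psi>"
    and subgrad: "\<And>k. v k \<in> subdifferential \<psi> (y (Suc k))"
    and step: "\<And>k. y (Suc k) =
        y k - lam *\<^sub>R gradient (convex_conjugate (power_prox_fun r p)) (v k)"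
    and Y: "Y = argmin_set \<psi>"
    and Y_nonempty: "Y \<noteq> {}"
    and Y_compact: "compact Y"
    and \<psi>min: "\<psi>min = (INF z. \<psi> z)"
    and \<delta>: "\<delta> > 0"
    and \<mu>: "\<mu> > 0"
    and \<nu>: "\<nu> > 1"
    and growth: "\<And>x. lr_dist r x Y < \<delta> \<Longrightarrow> \<psi> x - \<psi>min \<ge> ereal (\<mu> * lr_dist r x Y powr \<nu>)"
    and p_gt: "p > \<nu> - 1"
    and \<omega>: "\<omega> = p / (\<nu> - 1)"
    and \<alpha>: "\<alpha> = (1 / (lam * \<mu> powr q)) powr \<omega>"
  shows "\<omega> > 1
    \<and> (\<lambda>k. lr_dist r (y k) Y) \<longlonglongrightarrow> 0
    \<and> (\<forall>\<^sub>F k in sequentially.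
          lr_dist r (y (Suc k)) Y \<le> \<alpha> * lr_dist r (y k) Y powr \<omega>)"
proof -
  have p0: "p > 0"
    using p by simp
  have "q + 1 \<noteq> 0"
    using q p by auto
  then have q': "q = 1 / p"
    using q p by (simp add: field_simps)
  obtain G where "power_duality (lr_norm r) p (G :: real ^ 'm \<Rightarrow> real ^ 'm)"
    using r power_duality_Euclidean[OF p0] power_duality_lr[OF p0] by blast
  then interpret power_duality "lr_norm r" p G .
  have phi: "power_prox_fun r p = phi"
    by (simp add: fun_eq_iff power_prox_fun_def phi_def)
  have gdist: "lr_dist r x S = gdist x S" for x S
    by (simp add: lr_dist_def gdist_def)
  have step': "y (Suc k) = y k - lam *\<^sub>R G (v k)" for k
    using step[of k] by (simp add: phi gradient_conjugate_phi)
  have growth': "\<psi> x - (INF z. \<psi> z) \<ge> ereal (\<mu> * gdist x Y powr \<nu>)" if "gdist x Y < \<delta>" for x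
    using growth[of x] that by (simp add: gdist \<psi>min)
  note rate = power_proximal_point_local_rate[where \<psi> = \<psi> and y = y and v = v and S = Y and \<mu> = \<mu> and \<nu> = \<nu>, OF lam proper conv subgrad step' Y Y_nonempty Y_compact
      \<delta> \<mu> \<nu> growth' \<omega>]
  have "\<omega> > 1"
    using p_gt \<nu> by (simp add: \<omega>)
  with rate show ?thesis
    by (simp add: gdist \<alpha> q')
qed

end
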